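(* Let $q \sim \rho$ be a question and $o \sim \pi_\theta(\cdot \mid q)$ an output with reward $R(q,o) \in \{0,1\}$, where, given $q$, $R(q,o)$ follows a Bernoulli distribution with success probability $p(q) = \mathbb{E}_{o\sim\pi_\theta(\cdot\mid q)}[R(q,o)\mid q]$, and suppose that $p(q)$ (as a random variable under $q\sim\rho$) follows a Beta distribution with density $f_D(\,\cdot\,;a,b)$, $a,b>0$. For $\alpha,\beta>0$ define the BNPO gradient estimator $$g_{\alpha,\beta} = \nabla_\theta \log \pi_\theta(o\mid q)\, \frac{R(q,o)-p(q)}{f_N(p(q);\alpha,\beta)},$$ where $f_N(\,\cdot\,;\alpha,\beta)$ is the density of the Beta distribution with parameters $\alpha,\beta$. Assume that $\nabla_\theta \log \pi_\theta(o\mid q)$ is uncorrelated with $\frac{R(q,o)-p(q)}{f_N(p(q);\alpha,\beta)}$. Then the variance $\mathrm{Var}_{q\sim\rho,\,o\sim\pi_\theta(\cdot\mid q)}(g_{\alpha,\beta})$ is finite if and only if $$\alpha < \frac{a+3}{2} \quad\text{and}\quad \beta < \frac{b+3}{2}.$$ Within this domain of $(\alpha,\beta)$, $\mathrm{Var}_{q\sim\rho,\,o\sim\pi_\theta(\cdot\mid q)}(g_{\alpha,\beta})$ attains a unique minimum at $$\alpha = 1+\frac{a}{3},\qquad \beta = 1+\frac{b}{3}.$$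
   Context: Here $\rho$ is a probability distribution on questions $q$, and $\pi_\theta(\cdot\mid q)$ is a parameterized policy model (with parameter $\theta$), i.e. a probability distribution over outputs $o$ given $q$; $\nabla_\theta$ is the gradient with respect to $\theta$. The reward function $R(q,o)$ is binary-valued: it equals $1$ if the output $o$ contains the correct answer to the question $q$, and $0$ otherwise. For parameters $\alpha,\beta>0$, the Beta distribution on $[0,1]$ has density $$f(p;\alpha,\beta)=\frac{1}{\mathrm{B}(\alpha,\beta)}\,p^{\alpha-1}(1-p)^{\beta-1},\qquad p\in(0,1),$$ where $\mathrm{B}(\cdot,\cdot)$ is the Beta function. Both $f_D(\,\cdot\,;a,b)$ and $f_N(\,\cdot\,;\alpha,\beta)$ denote densities of this form: $f_D$ is the density of the law of the random variable $p(q)$, and $f_N$ is a function evaluated at $p(q)$ and used as a normalization factor. The variance is taken over the joint law of $(q,o)$ with $q\sim\rho$, $o\sim\pi_\theta(\cdot\mid q)$: $\mathrm{Var}(g)=\mathbb{E}[g^2]-(\mathbb{E}[g])^2$, where for a vector-valued $g$ the square means the squared Euclidean norm. "Uncorrelated" means that the expectation of the product of the two quantities equals the product of their expectations (componentwise for the gradient), under the same joint law; the assumption is made for the parameters $(\alpha,\beta)$ under consideration.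
   Formalization: Besides being uncorrelated, the score ∇_θ log π_θ and A=(R−p)/f_N are assumed to satisfy E[|score|²A²]=E[|score|²]E[A²], with 0<E|score|²<∞; uncorrelatedness alone does not make the claim true. *)

theory Defs
  imports "HOL-Probability.Probability"
begin

definition beta_density :: "real \<Rightarrow> real \<Rightarrow> real \<Rightarrow> real" where
  "beta_density \<alpha> \<beta> x =
     (if 0 < x \<and> x < 1 then x powr (\<alpha> - 1) * (1 - x) powr (\<beta> - 1) / Beta \<alpha> \<beta> else 0)"

text \<open>
  A policy is given by its densities \<open>\<pi> \<theta> q y\<close> with respect to a sigma-finite reference measure
  \<open>\<nu>\<close> on outputs; a counting measure \<open>\<nu>\<close> gives the case of probability mass functions.
\<close>

definition output_law :: "'y measure \<Rightarrow> ('p \<Rightarrow> 'q \<Rightarrow> 'y \<Rightarrow> real) \<Rightarrow> 'p \<Rightarrow> 'q \<Rightarrow> 'y measure" where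
  "output_law \<nu> \<pi> \<theta> q = density \<nu> (\<lambda>y. ennreal (\<pi> \<theta> q y))"

definition policy_model :: "'q measure \<Rightarrow> 'y measure \<Rightarrow> ('p \<Rightarrow> 'q \<Rightarrow> 'y \<Rightarrow> real) \<Rightarrow> bool" where
  "policy_model \<rho> \<nu> \<pi> \<longleftrightarrow>
     sigma_finite_measure \<nu> \<and>
     (\<forall>\<theta>. (\<lambda>(q, y). \<pi> \<theta> q y) \<in> borel_measurable (\<rho> \<Otimes>\<^sub>M \<nu>)) \<and>
     (\<forall>\<theta>. \<forall>q\<in>space \<rho>. (\<forall>y\<in>space \<nu>. 0 \<le> \<pi> \<theta> q y) \<and> prob_space (output_law \<nu> \<pi> \<theta> q))"

definition joint_law ::
  "'q measure \<Rightarrow> 'y measure \<Rightarrow> ('p \<Rightarrow> 'q \<Rightarrow> 'y \<Rightarrow> real) \<Rightarrow> 'p \<Rightarrow> ('q \<times> 'y) measure" where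
  "joint_law \<rho> \<nu> \<pi> \<theta> = density (\<rho> \<Otimes>\<^sub>M \<nu>) (\<lambda>(q, y). ennreal (\<pi> \<theta> q y))"

definition success_prob ::
  "'y measure \<Rightarrow> ('p \<Rightarrow> 'q \<Rightarrow> 'y \<Rightarrow> real) \<Rightarrow> ('q \<Rightarrow> 'y \<Rightarrow> real) \<Rightarrow> 'p \<Rightarrow> 'q \<Rightarrow> real" where
  "success_prob \<nu> \<pi> R \<theta> q = (\<integral>y. R q y \<partial>output_law \<nu> \<pi> \<theta> q)"

definition gradient :: "('p::euclidean_space \<Rightarrow> real) \<Rightarrow> 'p \<Rightarrow> 'p" where
  "gradient f x = (THE D. GDERIV f x :> D)"

definition score ::
  "('p::euclidean_space \<Rightarrow> 'q \<Rightarrow> 'y \<Rightarrow> real) \<Rightarrow> 'p \<Rightarrow> 'q \<times> 'y \<Rightarrow> 'p" where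
  "score \<pi> \<theta> = (\<lambda>(q, y). gradient (\<lambda>t. ln (\<pi> t q y)) \<theta>)"

definition bnpo_advantage ::
  "'y measure \<Rightarrow> ('p \<Rightarrow> 'q \<Rightarrow> 'y \<Rightarrow> real) \<Rightarrow> ('q \<Rightarrow> 'y \<Rightarrow> real) \<Rightarrow> 'p \<Rightarrow> real \<Rightarrow> real \<Rightarrow> 'q \<times> 'y \<Rightarrow> real" where
  "bnpo_advantage \<nu> \<pi> R \<theta> \<alpha> \<beta> =
     (\<lambda>(q, y). (R q y - success_prob \<nu> \<pi> R \<theta> q) / beta_density \<alpha> \<beta> (success_prob \<nu> \<pi> R \<theta> q))"

definition bnpo_gradient ::
  "'y measure \<Rightarrow> ('p::euclidean_space \<Rightarrow> 'q \<Rightarrow> 'y \<Rightarrow> real) \<Rightarrow> ('q \<Rightarrow> 'y \<Rightarrow> real) \<Rightarrow> 'p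
     \<Rightarrow> real \<Rightarrow> real \<Rightarrow> 'q \<times> 'y \<Rightarrow> 'p" where
  "bnpo_gradient \<nu> \<pi> R \<theta> \<alpha> \<beta> = (\<lambda>z. bnpo_advantage \<nu> \<pi> R \<theta> \<alpha> \<beta> z *\<^sub>R score \<pi> \<theta> z)"

text \<open>
  On a probability space an infinite second moment makes \<open>vec_variance\<close> infinite, while a finite
  second moment makes \<open>g\<close> integrable, so that the Bochner integral is its expectation. Hence the
  default value of the integral of a non-integrable \<open>g\<close> never matters.
\<close>

definition vec_variance :: "'a measure \<Rightarrow> ('a \<Rightarrow> 'p::euclidean_space) \<Rightarrow> ennreal" where
  "vec_variance M g =
     (\<integral>\<^sup>+z. ennreal ((norm (g z))\<^sup>2) \<partial>M) - ennreal ((norm (\<integral>z. g z \<partial>M))\<^sup>2)"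

definition uncorrelated :: "'a measure \<Rightarrow> ('a \<Rightarrow> 'p::euclidean_space) \<Rightarrow> ('a \<Rightarrow> real) \<Rightarrow> bool" where
  "uncorrelated M X A \<longleftrightarrow>
     (\<forall>b\<in>Basis. (\<integral>z. (X z \<bullet> b) * A z \<partial>M) = (\<integral>z. X z \<bullet> b \<partial>M) * (\<integral>z. A z \<partial>M))"

text \<open>
  Uncorrelatedness of the squares, with expectations in \<open>[0, \<infinity>]\<close>. It yields
  \<open>E[|X|\<^sup>2 A\<^sup>2] = E[|X|\<^sup>2] E[A\<^sup>2]\<close>, which uncorrelatedness of \<open>X\<close> and \<open>A\<close> alone does not.
\<close>

definition square_uncorrelated ::
  "'a measure \<Rightarrow> ('a \<Rightarrow> 'p::euclidean_space) \<Rightarrow> ('a \<Rightarrow> real) \<Rightarrow> bool" where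
  "square_uncorrelated M X A \<longleftrightarrow>
     (\<integral>\<^sup>+z. ennreal ((norm (X z))\<^sup>2 * (A z)\<^sup>2) \<partial>M)
       = (\<integral>\<^sup>+z. ennreal ((norm (X z))\<^sup>2) \<partial>M) * (\<integral>\<^sup>+z. ennreal ((A z)\<^sup>2) \<partial>M)"

definition bnpo_uncorrelated ::
  "'q measure \<Rightarrow> 'y measure \<Rightarrow> ('p::euclidean_space \<Rightarrow> 'q \<Rightarrow> 'y \<Rightarrow> real) \<Rightarrow> ('q \<Rightarrow> 'y \<Rightarrow> real) \<Rightarrow> 'p
     \<Rightarrow> real \<Rightarrow> real \<Rightarrow> bool" where
  "bnpo_uncorrelated \<rho> \<nu> \<pi> R \<theta> \<alpha> \<beta> \<longleftrightarrow>
     uncorrelated (joint_law \<rho> \<nu> \<pi> \<theta>) (score \<pi> \<theta>) (bnpo_advantage \<nu> \<pi> R \<theta> \<alpha> \<beta>) \<and>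
     square_uncorrelated (joint_law \<rho> \<nu> \<pi> \<theta>) (score \<pi> \<theta>) (bnpo_advantage \<nu> \<pi> R \<theta> \<alpha> \<beta>)"

definition bnpo_variance ::
  "'q measure \<Rightarrow> 'y measure \<Rightarrow> ('p::euclidean_space \<Rightarrow> 'q \<Rightarrow> 'y \<Rightarrow> real) \<Rightarrow> ('q \<Rightarrow> 'y \<Rightarrow> real) \<Rightarrow> 'p
     \<Rightarrow> real \<Rightarrow> real \<Rightarrow> ennreal" where
  "bnpo_variance \<rho> \<nu> \<pi> R \<theta> \<alpha> \<beta> =
     vec_variance (joint_law \<rho> \<nu> \<pi> \<theta>) (bnpo_gradient \<nu> \<pi> R \<theta> \<alpha> \<beta>)"

definition parameter_domain :: "real \<Rightarrow> real \<Rightarrow> (real \<times> real) set" where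
  "parameter_domain a b =
     {(\<alpha>, \<beta>). 0 < \<alpha> \<and> 0 < \<beta> \<and> \<alpha> < (a + 3) / 2 \<and> \<beta> < (b + 3) / 2}"

end

theory Submission
  imports Defs
begin

text \<open>
  Given the question, the advantage has mean \<open>0\<close> and second moment \<open>p (1 - p) / f\<^sub>N(p)\<^sup>2\<close>, so the
  variance is \<open>E |score|\<^sup>2\<close> times the integral of \<open>x (1 - x) f\<^sub>D / u\<^sup>2\<close> with \<open>u = f\<^sub>N\<close>. This is a Beta
  integral with parameters \<open>a + 3 - 2\<alpha>\<close> and \<open>b + 3 - 2\<beta>\<close>, finite iff both are positive. Moreover
  \<open>x (1 - x) f\<^sub>D\<close> is a constant times \<open>w\<^sup>3\<close>, where \<open>w\<close> is the Beta density with parameters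
  \<open>1 + a/3\<close>, \<open>1 + b/3\<close>. Integrating the AM-GM inequality \<open>w\<^sup>3 / u\<^sup>2 \<ge> 3 w - 2 u\<close>, which is strict
  for \<open>w \<noteq> u\<close>, gives at least \<open>1\<close>, with equality only if \<open>u = w\<close>.
\<close>

section \<open>Beta integrals\<close>

text \<open>Left unnormalised so that it makes sense for all real parameters, including those for
  which the integral diverges and no normalising constant exists.\<close>

definition beta_kernel :: "real \<Rightarrow> real \<Rightarrow> real \<Rightarrow> real" where
  "beta_kernel s t x = (if 0 < x \<and> x < 1 then x powr (s - 1) * (1 - x) powr (t - 1) else 0)"

lemma beta_kernel_nonneg: "0 \<le> beta_kernel s t x"
  by (simp add: beta_kernel_def)

lemma borel_measurable_beta_kernel [measurable]: "beta_kernel s t \<in> borel_measurable borel"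
  unfolding beta_kernel_def[abs_def] by measurable

lemma beta_density_eq_kernel: "beta_density \<alpha> \<beta> x = beta_kernel \<alpha> \<beta> x / Beta \<alpha> \<beta>"
  by (simp add: beta_density_def beta_kernel_def)

lemma borel_measurable_beta_density [measurable]: "beta_density \<alpha> \<beta> \<in> borel_measurable borel"
  unfolding beta_density_eq_kernel[abs_def] by measurable

lemma Beta_real_pos:
  fixes s t :: real
  assumes "0 < s" "0 < t"
  shows "0 < Beta s t"
  using assms by (simp add: Beta_def)

lemma nn_integral_beta_kernel:
  assumes "0 < s" "0 < t"
  shows "(\<integral>\<^sup>+x. ennreal (beta_kernel s t x) \<partial>lborel) = ennreal (Beta s t)"
proof -
  have "((\<lambda>x. x powr (s - 1) * (1 - x) powr (t - 1)) has_integral Beta s t) {0<..<1}"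
    using has_integral_Beta_real[OF assms] by (simp add: has_integral_Icc_iff_Ioo)
  then have "(\<integral>\<^sup>+x. ennreal (x powr (s - 1) * (1 - x) powr (t - 1)) * indicator {0<..<1} x \<partial>lborel)
      = ennreal (Beta s t)"
    by (intro nn_integral_has_integral_lebesgue') auto
  also have "(\<integral>\<^sup>+x. ennreal (x powr (s - 1) * (1 - x) powr (t - 1)) * indicator {0<..<1} x \<partial>lborel)
      = (\<integral>\<^sup>+x. ennreal (beta_kernel s t x) \<partial>lborel)"
    by (intro nn_integral_cong) (auto simp: beta_kernel_def indicator_def)
  finally show ?thesis .
qed

text \<open>Near 0 the kernel dominates a multiple of \<open>1 / x\<close>, whose integral over
  \<open>{e..1/2}\<close> grows without bound as \<open>e\<close> tends to 0.\<close>

lemma nn_integral_beta_kernel_infinite_left: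
  assumes "s \<le> 0"
  shows "(\<integral>\<^sup>+x. ennreal (beta_kernel s t x) \<partial>lborel) = \<infinity>"
proof -
  \<comment> \<open>A lower bound for the factor \<open>(1 - x) powr (t - 1)\<close> on (0, 1/2]: if
    t \<ge> 1 the factor is smallest at 1/2, otherwise it is at least 1.\<close>
  define c where "c = min 1 ((1/2) powr (t - 1) :: real)"
  have c: "0 < c" by (simp add: c_def)
  have lower: "of_nat n \<le> (\<integral>\<^sup>+x. ennreal (beta_kernel s t x) \<partial>lborel)" for n
  proof -
    \<comment> \<open>Chosen so that the integral of \<open>c / x\<close> over
      \<open>{e..1/2}\<close>, which is \<open>c * ln (1 / (2 * e))\<close>, equals exactly
      n.\<close>
    define e where "e = exp (- (real n / c)) / 2"
    have e: "0 < e" "e \<le> 1/2" using c by (simp_all add: e_def)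
    have "((\<lambda>x. c / x) has_integral (c * ln (1/2) - c * ln e)) {e..1/2}"
      using e by (intro fundamental_theorem_of_calculus)
        (auto intro!: derivative_eq_intros simp flip: has_real_derivative_iff_has_vector_derivative)
    then have "(\<integral>\<^sup>+x. ennreal (c / x) * indicator {e..1/2} x \<partial>lborel)
        = ennreal (c * ln (1/2) - c * ln e)"
      using c e by (intro nn_integral_has_integral_lebesgue') auto
    also have "c * ln (1/2) - c * ln e = real n"
      using c by (simp add: e_def ln_div right_diff_distrib)
    finally have eq: "(\<integral>\<^sup>+x. ennreal (c / x) * indicator {e..1/2} x \<partial>lborel) = of_nat n"
      by (simp add: ennreal_of_nat_eq_real_of_nat)
    have "ennreal (c / x) * indicator {e..1/2} x \<le> ennreal (beta_kernel s t x)" for x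
    proof (cases "x \<in> {e..1/2}")
      case True
      then have x: "0 < x" "x \<le> 1/2" using e by auto
      have "c \<le> (1 - x) powr (t - 1)"
      proof (cases "t \<ge> 1")
        case True
        have "(1/2) powr (t - 1) \<le> (1 - x) powr (t - 1)"
          using True x by (intro powr_mono2) auto
        then show ?thesis by (simp add: c_def)
      next
        case False
        have "1 powr (t - 1) \<le> (1 - x) powr (t - 1)"
          using False x by (intro powr_mono2') auto
        then show ?thesis by (simp add: c_def)
      qed
      moreover have "1 / x \<le> x powr (s - 1)"
        using powr_mono'[of "s - 1" "-1" x] x assms by (simp add: powr_minus_divide)
      ultimately have "1 / x * c \<le> x powr (s - 1) * (1 - x) powr (t - 1)"
        using x c by (intro mult_mono) auto
      then show ?thesis
        using True x by (auto simp: beta_kernel_def intro!: ennreal_leI)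
    qed simp
    then show ?thesis
      unfolding eq[symmetric] by (intro nn_integral_mono)
  qed
  show ?thesis
  proof (rule ccontr)
    assume "(\<integral>\<^sup>+x. ennreal (beta_kernel s t x) \<partial>lborel) \<noteq> \<infinity>"
    then obtain n where "(\<integral>\<^sup>+x. ennreal (beta_kernel s t x) \<partial>lborel) < of_nat n"
      using ennreal_Ex_less_of_nat[of "\<integral>\<^sup>+x. ennreal (beta_kernel s t x) \<partial>lborel"]
      by (auto simp: top.not_eq_extremum)
    with lower[of n] show False by simp
  qed
qed

text \<open>The reflection of x to 1 - x exchanges the two parameters, so a singularity at 1 reduces
  to one at 0.\<close>

lemma nn_integral_beta_kernel_infinite:
  assumes "s \<le> 0 \<or> t \<le> 0"
  shows "(\<integral>\<^sup>+x. ennreal (beta_kernel s t x) \<partial>lborel) = \<infinity>"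
proof (cases "s \<le> 0")
  case True
  then show ?thesis by (rule nn_integral_beta_kernel_infinite_left)
next
  case False
  have "beta_kernel s t (1 + (-1) * x) = beta_kernel t s x" for x
    by (simp add: beta_kernel_def)
  then have "(\<integral>\<^sup>+x. ennreal (beta_kernel s t x) \<partial>lborel)
      = (\<integral>\<^sup>+x. ennreal (beta_kernel t s x) \<partial>lborel)"
    by (subst nn_integral_real_affine[where c = "-1" and t = 1]) simp_all
  also have "\<dots> = \<infinity>"
    using assms False by (intro nn_integral_beta_kernel_infinite_left) simp
  finally show ?thesis .
qed

section \<open>Beta densities determine their parameters\<close>

lemma beta_density_pos: "0 < \<alpha> \<Longrightarrow> 0 < \<beta> \<Longrightarrow> 0 < x \<Longrightarrow> x < 1 \<Longrightarrow> 0 < beta_density \<alpha> \<beta> x"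
  by (simp add: beta_density_def Beta_real_pos)

lemma nn_integral_beta_density:
  assumes "0 < \<alpha>" "0 < \<beta>"
  shows "(\<integral>\<^sup>+x. ennreal (beta_density \<alpha> \<beta> x) \<partial>lborel) = 1"
proof -
  have "(\<integral>\<^sup>+x. ennreal (beta_density \<alpha> \<beta> x) \<partial>lborel)
      = (\<integral>\<^sup>+x. ennreal (1 / Beta \<alpha> \<beta>) * ennreal (beta_kernel \<alpha> \<beta> x) \<partial>lborel)"
    using Beta_real_pos[OF assms]
    by (intro nn_integral_cong) (simp add: beta_density_eq_kernel beta_kernel_nonneg flip: ennreal_mult)
  also have "\<dots> = ennreal (1 / Beta \<alpha> \<beta>) * ennreal (Beta \<alpha> \<beta>)"
    by (simp add: nn_integral_cmult nn_integral_beta_kernel assms)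
  also have "\<dots> = 1"
    using Beta_real_pos[OF assms] by (simp flip: ennreal_mult)
  finally show ?thesis .
qed

text \<open>Taking logarithms and differentiating reduces proportionality of the kernels to a linear relation.\<close>

lemma beta_density_eq_imp_parameters_eq:
  assumes pos: "0 < \<alpha>" "0 < \<beta>" "0 < \<gamma>" "0 < \<delta>"
    and eq: "\<And>x. 0 < x \<Longrightarrow> x < 1 \<Longrightarrow> beta_density \<alpha> \<beta> x = beta_density \<gamma> \<delta> x"
  shows "\<alpha> = \<gamma> \<and> \<beta> = \<delta>"
proof -
  define h where "h x = (\<alpha> - \<gamma>) * ln x + (\<beta> - \<delta>) * ln (1 - x)" for x :: real
  have h: "h x = ln (Beta \<alpha> \<beta>) - ln (Beta \<gamma> \<delta>)" if x: "0 < x" "x < 1" for x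
  proof -
    have ln_eq: "ln (beta_density s t x) = (s - 1) * ln x + (t - 1) * ln (1 - x) - ln (Beta s t)"
      if "0 < s" "0 < t" for s t
      using Beta_real_pos[OF that] x by (simp add: beta_density_def ln_div ln_mult ln_powr)
    show ?thesis
      using ln_eq[of \<alpha> \<beta>] ln_eq[of \<gamma> \<delta>] eq[OF x] pos by (simp add: h_def algebra_simps)
  qed
  have deriv: "(\<alpha> - \<gamma>) / x - (\<beta> - \<delta>) / (1 - x) = 0" if x: "0 < x" "x < 1" for x
  proof -
    have "(h has_real_derivative (\<alpha> - \<gamma>) / x - (\<beta> - \<delta>) / (1 - x)) (at x)"
      unfolding h_def[abs_def] using x by (auto intro!: derivative_eq_intros simp: divide_inverse)
    moreover have "(h has_real_derivative 0) (at x)"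
      by (rule has_field_derivative_transform_within_open[where S = "{0<..<1}" and
            f = "\<lambda>_. ln (Beta \<alpha> \<beta>) - ln (Beta \<gamma> \<delta>)"]) (use x h in auto)
    ultimately show ?thesis by (rule DERIV_unique)
  qed
  \<comment> \<open>The two points give \<alpha> - \<gamma> = \<beta> - \<delta> and 2 (\<alpha> -
    \<gamma>) = \<beta> - \<delta>, so both differences vanish.\<close>
  from deriv[of "1/2"] deriv[of "1/3"] show ?thesis by simp
qed

lemma continuous_on_beta_density: "continuous_on {0<..<1} (beta_density \<alpha> \<beta>)"
proof -
  have "continuous_on {0<..<1} (\<lambda>x. x powr (\<alpha> - 1) * (1 - x) powr (\<beta> - 1) * (1 / Beta \<alpha> \<beta>))"
    by (intro continuous_intros) auto
  then show ?thesis
    by (rule continuous_on_eq) (simp add: beta_density_def)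
qed

text \<open>The points of \<open>S\<close> where the functions differ form an open null set, and a
  nonempty open set is not null. This upgrades almost everywhere equality of densities to pointwise
  equality.\<close>

lemma AE_lborel_continuous_on_eq:
  fixes f g :: "real \<Rightarrow> real"
  assumes "open S" "continuous_on S f" "continuous_on S g"
    and "AE x in lborel. x \<in> S \<longrightarrow> f x = g x"
    and "x \<in> S"
  shows "f x = g x"
proof (rule ccontr)
  assume neq: "f x \<noteq> g x"
  \<comment> \<open>The disagreement set is written as a preimage of the open set
    \<open>- {0}\<close>, so that continuity makes it open.\<close>
  define U where "U = {y \<in> S. f y - g y \<in> - {0}}"
  have "open U"
    unfolding U_def using assms(1-3)
    by (intro continuous_open_preimage[unfolded vimage_def Int_def mem_Collect_eq] continuous_intros) auto
  moreover have "x \<in> U" using neq assms(5) by (simp add: U_def)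
  moreover have "negligible U"
  proof -
    obtain N where N: "N \<in> null_sets lborel" "{x \<in> space lborel. \<not> (x \<in> S \<longrightarrow> f x = g x)} \<subseteq> N"
      using assms(4) by (auto simp: eventually_ae_filter)
    have "negligible N"
      using N(1) by (simp add: negligible_iff_null_sets null_sets_completionI)
    then show ?thesis
      by (rule negligible_subset) (use N(2) in \<open>auto simp: U_def\<close>)
  qed
  ultimately show False using open_not_negligible by blast
qed

section \<open>Second moment of the advantage\<close>

text \<open>This is AM-GM for the three numbers \<open>w ^ 3 / u\<^sup>2\<close>, u, u, whose
  product is \<open>w ^ 3\<close>. The explicit factorisation of the difference, with w + 2 u
  positive, also settles the equality case.\<close>

lemma weighted_AM_GM_cubic:
  fixes u w :: real
  assumes "0 < u" "0 < w"
  shows "3 * w \<le> w ^ 3 / u\<^sup>2 + 2 * u" and "3 * w = w ^ 3 / u\<^sup>2 + 2 * u \<Longrightarrow> w = u"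
proof -
  have eq: "w ^ 3 / u\<^sup>2 + 2 * u - 3 * w = (w - u)\<^sup>2 * (w + 2 * u) / u\<^sup>2"
    using assms by (simp add: field_simps power2_eq_square power3_eq_cube)
  moreover have "0 \<le> (w - u)\<^sup>2 * (w + 2 * u) / u\<^sup>2"
    using assms by simp
  ultimately show "3 * w \<le> w ^ 3 / u\<^sup>2 + 2 * u" by linarith
  assume "3 * w = w ^ 3 / u\<^sup>2 + 2 * u"
  with eq have "(w - u)\<^sup>2 * (w + 2 * u) / u\<^sup>2 = 0" by linarith
  with assms show "w = u" by auto
qed

text \<open>Both densities have integral 1, so the integrated AM-GM inequality reads 3 < J + 2.
  Equality almost everywhere would make the densities agree on (0, 1) by continuity, hence also
  their parameters. The integral is taken in [0, \<infinity>], so the divergent case is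
  covered.\<close>

lemma nn_integral_cube_div_square_beta_density:
  assumes pos: "0 < \<alpha>" "0 < \<beta>" "0 < \<gamma>" "0 < \<delta>" and neq: "(\<alpha>, \<beta>) \<noteq> (\<gamma>, \<delta>)"
  shows "1 < (\<integral>\<^sup>+x. ennreal (beta_density \<gamma> \<delta> x ^ 3 / (beta_density \<alpha> \<beta> x)\<^sup>2) \<partial>lborel)"
proof -
  let ?u = "beta_density \<alpha> \<beta>" and ?w = "beta_density \<gamma> \<delta>"
  let ?J = "\<integral>\<^sup>+x. ennreal (?w x ^ 3 / (?u x)\<^sup>2) \<partial>lborel"
  have nonneg: "0 \<le> ?u x" "0 \<le> ?w x" for x
    using pos Beta_real_pos[of \<alpha> \<beta>] Beta_real_pos[of \<gamma> \<delta>]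
    by (simp_all add: beta_density_def less_imp_le)
  have off: "?u x = 0 \<and> ?w x = 0" if "\<not> (0 < x \<and> x < 1)" for x
    using that by (auto simp: beta_density_def)
  \<comment> \<open>Outside (0, 1) both densities are 0 and the quotient is 0 by the convention on
    division by 0.\<close>
  have le: "3 * ?w x \<le> ?w x ^ 3 / (?u x)\<^sup>2 + 2 * ?u x" for x
    using weighted_AM_GM_cubic(1)[OF beta_density_pos[of \<alpha> \<beta> x] beta_density_pos[of \<gamma> \<delta> x]] pos off[of x]
    by (cases "0 < x \<and> x < 1") auto
  have "(\<integral>\<^sup>+x. ennreal (3 * ?w x) \<partial>lborel) < (\<integral>\<^sup>+x. ennreal (?w x ^ 3 / (?u x)\<^sup>2 + 2 * ?u x) \<partial>lborel)"
  proof (rule nn_integral_less)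
    show "(\<integral>\<^sup>+x. ennreal (3 * ?w x) \<partial>lborel) \<noteq> \<infinity>"
      using pos nonneg by (simp add: ennreal_mult nn_integral_cmult nn_integral_beta_density)
    show "AE x in lborel. ennreal (3 * ?w x) \<le> ennreal (?w x ^ 3 / (?u x)\<^sup>2 + 2 * ?u x)"
      using le by (intro AE_I2 ennreal_leI)
    show "\<not> (AE x in lborel. ennreal (?w x ^ 3 / (?u x)\<^sup>2 + 2 * ?u x) \<le> ennreal (3 * ?w x))"
    proof
      assume "AE x in lborel. ennreal (?w x ^ 3 / (?u x)\<^sup>2 + 2 * ?u x) \<le> ennreal (3 * ?w x)"
      then have "AE x in lborel. x \<in> {0<..<1} \<longrightarrow> ?w x = ?u x"
      proof (rule AE_mp, intro AE_I2 impI)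
        fix x :: real
        assume A: "ennreal (?w x ^ 3 / (?u x)\<^sup>2 + 2 * ?u x) \<le> ennreal (3 * ?w x)" and "x \<in> {0<..<1}"
        then have x: "0 < x" "x < 1" by auto
        from A have "?w x ^ 3 / (?u x)\<^sup>2 + 2 * ?u x \<le> 3 * ?w x"
          using nonneg(2)[of x] by (simp only: ennreal_le_iff mult_nonneg_nonneg zero_le_numeral)
        with le[of x] have "3 * ?w x = ?w x ^ 3 / (?u x)\<^sup>2 + 2 * ?u x" by simp
        then show "?w x = ?u x"
          using pos x by (auto intro: weighted_AM_GM_cubic(2)[OF beta_density_pos beta_density_pos])
      qed
      then have "?w x = ?u x" if "0 < x" "x < 1" for x
        using AE_lborel_continuous_on_eq[of "{0<..<1}" ?w ?u x] that
        by (simp add: continuous_on_beta_density)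
      then have "\<gamma> = \<alpha> \<and> \<delta> = \<beta>"
        using pos by (intro beta_density_eq_imp_parameters_eq)
      with neq show False by simp
    qed
  qed measurable
  moreover have "(\<integral>\<^sup>+x. ennreal (3 * ?w x) \<partial>lborel) = 3"
    using pos nonneg by (simp add: ennreal_mult nn_integral_cmult nn_integral_beta_density)
  moreover have "(\<integral>\<^sup>+x. ennreal (?w x ^ 3 / (?u x)\<^sup>2 + 2 * ?u x) \<partial>lborel) = ?J + 2"
    using pos nonneg
    by (simp add: ennreal_plus ennreal_mult nn_integral_add nn_integral_cmult nn_integral_beta_density)
  \<comment> \<open>The summand 2 is cancelled by contraposition: \<open>?J \<le> 1\<close> would
    give \<open>?J + 2 \<le> 1 + 2\<close>.\<close>
  ultimately have "(1::ennreal) + 2 < ?J + 2" by simp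
  then show ?thesis
    by (meson add_right_mono leD leI)
qed

section \<open>Finiteness and minimum of the Beta second moment\<close>

lemma beta_second_moment_integrand:
  assumes pos: "0 < a" "0 < b" "0 < \<alpha>" "0 < \<beta>"
  shows "beta_density a b x * (x * (1 - x) / (beta_density \<alpha> \<beta> x)\<^sup>2)
    = (Beta \<alpha> \<beta>)\<^sup>2 / Beta a b * beta_kernel (a + 3 - 2 * \<alpha>) (b + 3 - 2 * \<beta>) x"
proof (cases "0 < x \<and> x < 1")
  case True
  \<comment> \<open>Exponent count at one endpoint: (c - 1) + 1 - 2 (d - 1) = (c + 3 - 2 d) - 1,
    where + 1 comes from the Bernoulli variance and - 2 (d - 1) from the squared normaliser. The
    thresholds (a + 3) / 2 and (b + 3) / 2 originate here.\<close>
  have powr: "y powr (c - 1) * y / (y powr (d - 1))\<^sup>2 = y powr (c + 3 - 2 * d - 1)" if "0 < y" for c d y :: real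
  proof -
    have "y powr (c + 3 - 2 * d - 1) = y powr ((c - 1) + 1 - 2 * (d - 1))"
      by (rule arg_cong) simp
    also have "\<dots> = y powr (c - 1) * y / y powr (2 * (d - 1))"
      using that by (simp only: powr_diff powr_add powr_one)
    also have "y powr (2 * (d - 1)) = (y powr (d - 1))\<^sup>2"
      by (simp only: powr_add power2_eq_square mult_2)
    finally show ?thesis by simp
  qed
  have "beta_density a b x * (x * (1 - x) / (beta_density \<alpha> \<beta> x)\<^sup>2)
    = (Beta \<alpha> \<beta>)\<^sup>2 / Beta a b * ((x powr (a - 1) * x / (x powr (\<alpha> - 1))\<^sup>2)
        * ((1 - x) powr (b - 1) * (1 - x) / ((1 - x) powr (\<beta> - 1))\<^sup>2))"
    using True Beta_real_pos[OF pos(1,2)] Beta_real_pos[OF pos(3,4)]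
    by (simp add: beta_density_def power_mult_distrib power_divide divide_simps)
  then show ?thesis
    using True powr[of x a \<alpha>] powr[of "1 - x" b \<beta>] by (simp add: beta_kernel_def)
next
  case False
  then show ?thesis by (auto simp: beta_kernel_def beta_density_def)
qed

text \<open>The factor next to the density of p(q) is the conditional second moment of the advantage
  at success probability x. The two factors are separate \<open>ennreal\<close> terms to fit
  \<open>distributed_nn_integral\<close>, and divergence appears as the value \<infinity>.\<close>

definition beta_second_moment :: "real \<Rightarrow> real \<Rightarrow> real \<Rightarrow> real \<Rightarrow> ennreal" where
  "beta_second_moment a b \<alpha> \<beta> =
     (\<integral>\<^sup>+x. ennreal (beta_density a b x) * ennreal (x * (1 - x) / (beta_density \<alpha> \<beta> x)\<^sup>2) \<partial>lborel)"

lemma beta_second_moment_eq: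
  assumes pos: "0 < a" "0 < b" "0 < \<alpha>" "0 < \<beta>"
  shows "beta_second_moment a b \<alpha> \<beta> = ennreal ((Beta \<alpha> \<beta>)\<^sup>2 / Beta a b)
    * (\<integral>\<^sup>+x. ennreal (beta_kernel (a + 3 - 2 * \<alpha>) (b + 3 - 2 * \<beta>) x) \<partial>lborel)"
proof -
  have nonneg: "0 \<le> beta_density a b x" for x
    using Beta_real_pos[OF pos(1,2)] by (simp add: beta_density_def)
  have "beta_second_moment a b \<alpha> \<beta> = (\<integral>\<^sup>+x. ennreal ((Beta \<alpha> \<beta>)\<^sup>2 / Beta a b)
      * ennreal (beta_kernel (a + 3 - 2 * \<alpha>) (b + 3 - 2 * \<beta>) x) \<partial>lborel)"
    unfolding beta_second_moment_def
  proof (intro nn_integral_cong)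
    fix x :: real
    have "ennreal (beta_density a b x) * ennreal (x * (1 - x) / (beta_density \<alpha> \<beta> x)\<^sup>2)
        = ennreal (beta_density a b x * (x * (1 - x) / (beta_density \<alpha> \<beta> x)\<^sup>2))"
      by (rule ennreal_mult'[OF nonneg, symmetric])
    also have "\<dots> = ennreal ((Beta \<alpha> \<beta>)\<^sup>2 / Beta a b)
      * ennreal (beta_kernel (a + 3 - 2 * \<alpha>) (b + 3 - 2 * \<beta>) x)"
      unfolding beta_second_moment_integrand[OF pos]
      using Beta_real_pos[OF pos(1,2)] by (intro ennreal_mult') simp
    finally show "ennreal (beta_density a b x) * ennreal (x * (1 - x) / (beta_density \<alpha> \<beta> x)\<^sup>2)
      = ennreal ((Beta \<alpha> \<beta>)\<^sup>2 / Beta a b) * ennreal (beta_kernel (a + 3 - 2 * \<alpha>) (b + 3 - 2 * \<beta>) x)" .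
  qed
  then show ?thesis by (simp add: nn_integral_cmult)
qed

lemma beta_second_moment_finite_iff:
  assumes pos: "0 < a" "0 < b" "0 < \<alpha>" "0 < \<beta>"
  shows "beta_second_moment a b \<alpha> \<beta> < \<infinity> \<longleftrightarrow> \<alpha> < (a + 3) / 2 \<and> \<beta> < (b + 3) / 2"
proof (cases "\<alpha> < (a + 3) / 2 \<and> \<beta> < (b + 3) / 2")
  case True
  then have "0 < a + 3 - 2 * \<alpha>" "0 < b + 3 - 2 * \<beta>" by auto
  then have "beta_second_moment a b \<alpha> \<beta> < \<infinity>"
    by (simp add: beta_second_moment_eq[OF pos] nn_integral_beta_kernel flip: ennreal_mult'')
      (simp add: ennreal_mult_less_top)
  with True show ?thesis by simp
next
  case False
  then have "a + 3 - 2 * \<alpha> \<le> 0 \<or> b + 3 - 2 * \<beta> \<le> 0" by auto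
  \<comment> \<open>The constant in front of the divergent integral must be strictly positive,
    because 0 times \<infinity> is 0 in \<open>ennreal\<close>.\<close>
  then have "beta_second_moment a b \<alpha> \<beta> = \<infinity>"
    using Beta_real_pos[OF pos(1,2)] Beta_real_pos[OF pos(3,4)]
    by (simp add: beta_second_moment_eq[OF pos] nn_integral_beta_kernel_infinite ennreal_mult_top)
  with False show ?thesis by simp
qed

text \<open>On (0, 1), x (1 - x) times the density of p(q) is proportional to
  \<open>x powr a * (1 - x) powr b\<close>. Its cube root has exponents a / 3 and b / 3, so it is a
  Beta kernel with parameters 1 + a / 3 and 1 + b / 3; this is where the minimiser comes
  from.\<close>

lemma beta_second_moment_eq_cube_div_square:
  assumes pos: "0 < a" "0 < b" "0 < \<alpha>" "0 < \<beta>"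
  shows "beta_second_moment a b \<alpha> \<beta> = ennreal (Beta (1 + a / 3) (1 + b / 3) ^ 3 / Beta a b)
    * (\<integral>\<^sup>+x. ennreal (beta_density (1 + a / 3) (1 + b / 3) x ^ 3 / (beta_density \<alpha> \<beta> x)\<^sup>2) \<partial>lborel)"
proof -
  let ?K = "Beta (1 + a / 3) (1 + b / 3) ^ 3 / Beta a b"
  have B: "0 < Beta a b" "0 < Beta (1 + a / 3) (1 + b / 3)"
    using pos by (auto intro!: Beta_real_pos)
  have cube: "beta_density a b x * (x * (1 - x)) = ?K * beta_density (1 + a / 3) (1 + b / 3) x ^ 3" for x
  proof (cases "0 < x \<and> x < 1")
    case True
    have powr: "y powr (c - 1) * y = (y powr (c / 3)) ^ 3" if "0 < y" for c y :: real
    proof -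
      have "y powr (c - 1) * y = y powr (c - 1 + 1)"
        using that by (simp only: powr_add powr_one)
      also have "\<dots> = y powr (c / 3 + c / 3 + c / 3)" by simp
      also have "\<dots> = (y powr (c / 3)) ^ 3"
        by (simp only: powr_add power3_eq_cube)
      finally show ?thesis .
    qed
    have "beta_density a b x * (x * (1 - x))
        = (x powr (a - 1) * x) * ((1 - x) powr (b - 1) * (1 - x)) / Beta a b"
      using True by (simp add: beta_density_def)
    also have "\<dots> = ?K * beta_density (1 + a / 3) (1 + b / 3) x ^ 3"
      using True B powr[of x a] powr[of "1 - x" b]
      by (simp add: beta_density_def power_mult_distrib power_divide)
    finally show ?thesis .
  qed (auto simp: beta_density_def)
  have nonneg: "0 \<le> beta_density a b x" "0 \<le> beta_density (1 + a / 3) (1 + b / 3) x" for x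
    using B by (simp_all add: beta_density_def)
  have "ennreal (beta_density a b x) * ennreal (x * (1 - x) / (beta_density \<alpha> \<beta> x)\<^sup>2)
      = ennreal ?K * ennreal (beta_density (1 + a / 3) (1 + b / 3) x ^ 3 / (beta_density \<alpha> \<beta> x)\<^sup>2)" for x
  proof -
    have "ennreal (beta_density a b x) * ennreal (x * (1 - x) / (beta_density \<alpha> \<beta> x)\<^sup>2)
        = ennreal (beta_density a b x * (x * (1 - x)) / (beta_density \<alpha> \<beta> x)\<^sup>2)"
      by (simp only: ennreal_mult'[OF nonneg(1), symmetric] times_divide_eq_right)
    also have "\<dots> = ennreal (?K * (beta_density (1 + a / 3) (1 + b / 3) x ^ 3 / (beta_density \<alpha> \<beta> x)\<^sup>2))"
      unfolding cube by simp
    also have "\<dots> = ennreal ?K * ennreal (beta_density (1 + a / 3) (1 + b / 3) x ^ 3 / (beta_density \<alpha> \<beta> x)\<^sup>2)"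
      using B by (intro ennreal_mult') simp
    finally show ?thesis .
  qed
  then show ?thesis
    by (simp add: beta_second_moment_def nn_integral_cmult)
qed

text \<open>At the minimiser the integral is 1, and elsewhere it exceeds 1. Multiplication by the
  positive finite constant \<open>?K\<close> keeps the inequality strict, even if the right side is
  infinite.\<close>

lemma beta_second_moment_minimum:
  assumes pos: "0 < a" "0 < b" "0 < \<alpha>" "0 < \<beta>" and neq: "(\<alpha>, \<beta>) \<noteq> (1 + a / 3, 1 + b / 3)"
  shows "beta_second_moment a b (1 + a / 3) (1 + b / 3) < beta_second_moment a b \<alpha> \<beta>"
proof -
  let ?K = "Beta (1 + a / 3) (1 + b / 3) ^ 3 / Beta a b"
  let ?w = "beta_density (1 + a / 3) (1 + b / 3)"
  have pos': "0 < 1 + a / 3" "0 < 1 + b / 3" using pos by simp_all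
  have K: "0 < ?K" using pos by (simp add: Beta_real_pos)
  \<comment> \<open>Where \<open>?w x\<close> is 0 this holds because 0 / 0 = 0.\<close>
  have "?w x ^ 3 / (?w x)\<^sup>2 = ?w x" for x
    by (simp add: power2_eq_square power3_eq_cube)
  then have "beta_second_moment a b (1 + a / 3) (1 + b / 3) = ennreal ?K * 1"
    by (simp add: beta_second_moment_eq_cube_div_square[OF pos(1,2) pos'] nn_integral_beta_density pos')
  also have "\<dots> < ennreal ?K * (\<integral>\<^sup>+x. ennreal (?w x ^ 3 / (beta_density \<alpha> \<beta> x)\<^sup>2) \<partial>lborel)"
    using nn_integral_cube_div_square_beta_density[OF pos(3,4) pos' neq] K
    by (intro ennreal_mult_strict_left_mono) auto
  also have "\<dots> = beta_second_moment a b \<alpha> \<beta>"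
    by (simp add: beta_second_moment_eq_cube_div_square[OF pos])
  finally show ?thesis .
qed

section \<open>The joint law of questions and outputs\<close>

text \<open>The reward side of the model at a fixed \<theta>. The score does not enter, so \<theta>
  may have any type. Measurability of the success probability is later obtained from its assumed
  distribution.\<close>

locale binary_reward_policy =
  fixes \<rho> :: "'q measure" and \<nu> :: "'y measure"
    and \<pi> :: "'p \<Rightarrow> 'q \<Rightarrow> 'y \<Rightarrow> real"
    and R :: "'q \<Rightarrow> 'y \<Rightarrow> real" and \<theta> :: 'p
  assumes prob_questions: "prob_space \<rho>"
    and policy_model: "policy_model \<rho> \<nu> \<pi>"
    and measurable_reward [measurable]: "(\<lambda>(q, y). R q y) \<in> borel_measurable (\<rho> \<Otimes>\<^sub>M \<nu>)"
    and binary_reward: "\<And>q y. q \<in> space \<rho> \<Longrightarrow> y \<in> space \<nu> \<Longrightarrow> R q y \<in> {0, 1}"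
    and measurable_success_prob [measurable]: "success_prob \<nu> \<pi> R \<theta> \<in> borel_measurable \<rho>"
begin

abbreviation "p \<equiv> success_prob \<nu> \<pi> R \<theta>"
abbreviation "P \<equiv> joint_law \<rho> \<nu> \<pi> \<theta>"
abbreviation "L \<equiv> output_law \<nu> \<pi> \<theta>"

sublocale questions: prob_space \<rho> by (rule prob_questions)
sublocale outputs: sigma_finite_measure \<nu> using policy_model by (simp add: policy_model_def)
sublocale pair_sigma_finite \<rho> \<nu> ..

lemma measurable_policy [measurable]: "(\<lambda>(q, y). \<pi> \<theta> q y) \<in> borel_measurable (\<rho> \<Otimes>\<^sub>M \<nu>)"
  using policy_model by (simp add: policy_model_def)

lemma policy_nonneg: "q \<in> space \<rho> \<Longrightarrow> y \<in> space \<nu> \<Longrightarrow> 0 \<le> \<pi> \<theta> q y"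
  using policy_model by (simp add: policy_model_def)

lemma prob_space_output_law: "q \<in> space \<rho> \<Longrightarrow> prob_space (L q)"
  using policy_model by (simp add: policy_model_def)

lemma sets_output_law [measurable_cong]: "sets (L q) = sets \<nu>"
  by (simp add: output_law_def)

lemma space_output_law: "space (L q) = space \<nu>"
  by (simp add: output_law_def)

text \<open>Tonelli for the product measure, with the policy density absorbed into the conditional
  law \<open>L q\<close>.\<close>

lemma nn_integral_joint_law:
  assumes [measurable]: "F \<in> borel_measurable (\<rho> \<Otimes>\<^sub>M \<nu>)"
  shows "(\<integral>\<^sup>+z. F z \<partial>P) = (\<integral>\<^sup>+q. (\<integral>\<^sup>+y. F (q, y) \<partial>L q) \<partial>\<rho>)"
proof -
  have "(\<integral>\<^sup>+z. F z \<partial>P) = (\<integral>\<^sup>+z. ennreal (case z of (q, y) \<Rightarrow> \<pi> \<theta> q y) * F z \<partial>(\<rho> \<Otimes>\<^sub>M \<nu>))"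
    unfolding joint_law_def by (subst nn_integral_density) (auto simp: case_prod_beta)
  also have "\<dots> = (\<integral>\<^sup>+q. (\<integral>\<^sup>+y. ennreal (\<pi> \<theta> q y) * F (q, y) \<partial>\<nu>) \<partial>\<rho>)"
    by (subst outputs.nn_integral_fst[symmetric]) auto
  also have "\<dots> = (\<integral>\<^sup>+q. (\<integral>\<^sup>+y. F (q, y) \<partial>L q) \<partial>\<rho>)"
    unfolding output_law_def by (intro nn_integral_cong) (subst nn_integral_density; simp)
  finally show ?thesis .
qed

text \<open>If \<open>F\<close> is not integrable, its Bochner integral is \<open>0\<close> by convention.\<close>

lemma integral_joint_law_eq_0:
  fixes F :: "'q \<times> 'y \<Rightarrow> real"
  assumes [measurable]: "F \<in> borel_measurable (\<rho> \<Otimes>\<^sub>M \<nu>)"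
    and zero: "\<And>q. q \<in> space \<rho> \<Longrightarrow> (\<integral>y. F (q, y) \<partial>L q) = 0"
  shows "(\<integral>z. F z \<partial>P) = 0"
proof -
  let ?G = "\<lambda>z. (case z of (q, y) \<Rightarrow> \<pi> \<theta> q y) * F z"
  have nonneg: "AE z in \<rho> \<Otimes>\<^sub>M \<nu>. 0 \<le> (case z of (q, y) \<Rightarrow> \<pi> \<theta> q y)"
    by (intro AE_I2) (auto simp: space_pair_measure policy_nonneg)
  have P: "P = density (\<rho> \<Otimes>\<^sub>M \<nu>) (\<lambda>z. ennreal (case z of (q, y) \<Rightarrow> \<pi> \<theta> q y))"
    unfolding joint_law_def by (rule arg_cong[where f = "density _"]) auto
  \<comment> \<open>Moving the density into the integrand leaves an integral over the product
    measure, to which Fubini applies.\<close>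
  have eq: "(\<integral>z. F z \<partial>P) = (\<integral>z. ?G z \<partial>(\<rho> \<Otimes>\<^sub>M \<nu>))"
    unfolding P using nonneg by (subst integral_density) auto
  show ?thesis
  proof (cases "integrable (\<rho> \<Otimes>\<^sub>M \<nu>) ?G")
    case True
    have "(\<integral>y. ?G (q, y) \<partial>\<nu>) = 0" if q: "q \<in> space \<rho>" for q
    proof -
      have [measurable]: "\<pi> \<theta> q \<in> borel_measurable \<nu>" "(\<lambda>y. F (q, y)) \<in> borel_measurable \<nu>"
        using q measurable_Pair2[OF measurable_policy q] by auto
      have "(\<integral>y. F (q, y) \<partial>L q) = (\<integral>y. \<pi> \<theta> q y *\<^sub>R F (q, y) \<partial>\<nu>)"
        unfolding output_law_def using q by (subst integral_density) (auto simp: policy_nonneg)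
      with zero[OF q] show ?thesis by simp
    qed
    then have "(\<integral>q. (\<integral>y. ?G (q, y) \<partial>\<nu>) \<partial>\<rho>) = (\<integral>q. 0 \<partial>\<rho>)"
      by (intro Bochner_Integration.integral_cong) auto
    with integral_fst'[OF True] eq show ?thesis by simp
  next
    case False
    then show ?thesis unfolding eq by (rule not_integrable_integral_eq)
  qed
qed

lemma integrable_reward:
  assumes q: "q \<in> space \<rho>"
  shows "integrable (L q) (R q)"
proof -
  interpret L: prob_space "L q" by (rule prob_space_output_law[OF q])
  have [measurable]: "R q \<in> borel_measurable \<nu>"
    using measurable_Pair2[OF measurable_reward q] by simp
  show ?thesis
    using binary_reward[OF q]
    by (intro L.integrable_const_bound[where B = 1] AE_I2) (force simp: space_output_law, measurable)
qed

text \<open>A value R in {0, 1} satisfies R * R = R, so the square is an affine function of R and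
  its expectation follows from E[R] = p.\<close>

lemma reward_variance:
  assumes q: "q \<in> space \<rho>"
  shows "integrable (L q) (\<lambda>y. (R q y - p q)\<^sup>2)"
    and "(\<integral>y. (R q y - p q)\<^sup>2 \<partial>L q) = p q * (1 - p q)"
proof -
  interpret L: prob_space "L q" by (rule prob_space_output_law[OF q])
  have eq: "(R q y - p q)\<^sup>2 = (1 - 2 * p q) * R q y + (p q)\<^sup>2" if "y \<in> space (L q)" for y
    using binary_reward[OF q, of y] that by (auto simp: space_output_law power2_eq_square algebra_simps)
  have int: "integrable (L q) (\<lambda>y. (1 - 2 * p q) * R q y + (p q)\<^sup>2)"
    using integrable_reward[OF q] by simp
  with eq show "integrable (L q) (\<lambda>y. (R q y - p q)\<^sup>2)"
    by (subst Bochner_Integration.integrable_cong[OF refl]) auto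
  have "(\<integral>y. (R q y - p q)\<^sup>2 \<partial>L q) = (\<integral>y. (1 - 2 * p q) * R q y + (p q)\<^sup>2 \<partial>L q)"
    using eq by (intro Bochner_Integration.integral_cong) auto
  also have "\<dots> = (1 - 2 * p q) * p q + (p q)\<^sup>2"
    using integrable_reward[OF q] by (simp add: success_prob_def L.prob_space)
  finally show "(\<integral>y. (R q y - p q)\<^sup>2 \<partial>L q) = p q * (1 - p q)"
    by (simp add: power2_eq_square algebra_simps)
qed

lemma measurable_advantage [measurable]:
  "bnpo_advantage \<nu> \<pi> R \<theta> \<alpha> \<beta> \<in> borel_measurable (\<rho> \<Otimes>\<^sub>M \<nu>)"
  unfolding bnpo_advantage_def by measurable

text \<open>Given q, the denominator is constant and the numerator is centred, so every conditional
  mean is 0.\<close>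

lemma integral_advantage: "(\<integral>z. bnpo_advantage \<nu> \<pi> R \<theta> \<alpha> \<beta> z \<partial>P) = 0"
proof (rule integral_joint_law_eq_0)
  fix q assume q: "q \<in> space \<rho>"
  interpret L: prob_space "L q" by (rule prob_space_output_law[OF q])
  show "(\<integral>y. bnpo_advantage \<nu> \<pi> R \<theta> \<alpha> \<beta> (q, y) \<partial>L q) = 0"
    using integrable_reward[OF q] by (simp add: bnpo_advantage_def success_prob_def L.prob_space)
qed measurable

text \<open>Conditioning on the question yields the Bernoulli variance over the squared normaliser.
  This depends on q through p(q) alone, so the integral over questions passes to the Beta
  law.\<close>

lemma nn_integral_advantage_square:
  assumes dist: "distributed \<rho> lborel p (\<lambda>x. ennreal (beta_density a b x))"
  shows "(\<integral>\<^sup>+z. ennreal ((bnpo_advantage \<nu> \<pi> R \<theta> \<alpha> \<beta> z)\<^sup>2) \<partial>P) = beta_second_moment a b \<alpha> \<beta>"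
proof -
  have "(\<integral>\<^sup>+z. ennreal ((bnpo_advantage \<nu> \<pi> R \<theta> \<alpha> \<beta> z)\<^sup>2) \<partial>P)
      = (\<integral>\<^sup>+q. (\<integral>\<^sup>+y. ennreal ((bnpo_advantage \<nu> \<pi> R \<theta> \<alpha> \<beta> (q, y))\<^sup>2) \<partial>L q) \<partial>\<rho>)"
    by (rule nn_integral_joint_law) measurable
  also have "\<dots> = (\<integral>\<^sup>+q. ennreal (p q * (1 - p q) / (beta_density \<alpha> \<beta> (p q))\<^sup>2) \<partial>\<rho>)"
  proof (intro nn_integral_cong)
    fix q assume q: "q \<in> space \<rho>"
    show "(\<integral>\<^sup>+y. ennreal ((bnpo_advantage \<nu> \<pi> R \<theta> \<alpha> \<beta> (q, y))\<^sup>2) \<partial>L q)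
        = ennreal (p q * (1 - p q) / (beta_density \<alpha> \<beta> (p q))\<^sup>2)"
      using reward_variance[OF q]
      by (subst nn_integral_eq_integral) (auto simp: bnpo_advantage_def power_divide)
  qed
  also have "\<dots> = beta_second_moment a b \<alpha> \<beta>"
    unfolding beta_second_moment_def by (rule distributed_nn_integral[OF dist, symmetric]) measurable
  finally show ?thesis .
qed

end

section \<open>Variance of the gradient estimator\<close>

text \<open>
  The centred advantage makes the expectation of the estimator vanish, so that its variance is its
  second moment, which factorises.
\<close>

lemma bnpo_variance_eq:
  fixes \<pi> :: "'p::euclidean_space \<Rightarrow> 'q \<Rightarrow> 'y \<Rightarrow> real"
  assumes "binary_reward_policy \<rho> \<nu> \<pi> R \<theta>"
    and dist: "distributed \<rho> lborel (success_prob \<nu> \<pi> R \<theta>) (\<lambda>x. ennreal (beta_density a b x))"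
    and uncorr: "bnpo_uncorrelated \<rho> \<nu> \<pi> R \<theta> \<alpha> \<beta>"
  shows "bnpo_variance \<rho> \<nu> \<pi> R \<theta> \<alpha> \<beta>
    = (\<integral>\<^sup>+z. ennreal ((norm (score \<pi> \<theta> z))\<^sup>2) \<partial>joint_law \<rho> \<nu> \<pi> \<theta>) * beta_second_moment a b \<alpha> \<beta>"
proof -
  interpret binary_reward_policy \<rho> \<nu> \<pi> R \<theta> by fact
  let ?A = "bnpo_advantage \<nu> \<pi> R \<theta> \<alpha> \<beta>" and ?g = "bnpo_gradient \<nu> \<pi> R \<theta> \<alpha> \<beta>"
  \<comment> \<open>Uncorrelatedness gives 0 in each coordinate if the estimator is integrable;
    otherwise the Bochner integral is 0 by convention.\<close>
  have mean: "(\<integral>z. ?g z \<partial>P) = 0"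
  proof (cases "integrable P ?g")
    case True
    show ?thesis
    proof (rule euclidean_eqI)
      fix i :: 'p assume i: "i \<in> Basis"
      have "(\<integral>z. ?g z \<partial>P) \<bullet> i = (\<integral>z. ?g z \<bullet> i \<partial>P)"
        using True by simp
      also have "\<dots> = (\<integral>z. (score \<pi> \<theta> z \<bullet> i) * ?A z \<partial>P)"
        by (simp add: bnpo_gradient_def mult.commute)
      also have "\<dots> = (\<integral>z. score \<pi> \<theta> z \<bullet> i \<partial>P) * (\<integral>z. ?A z \<partial>P)"
        using uncorr i by (simp add: bnpo_uncorrelated_def uncorrelated_def)
      finally show "(\<integral>z. ?g z \<partial>P) \<bullet> i = 0 \<bullet> i"
        by (simp add: integral_advantage)
    qed
  qed (rule not_integrable_integral_eq)
  \<comment> \<open>With mean 0, the truncated subtraction in \<open>vec_variance\<close> removes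
    nothing.\<close>
  have "bnpo_variance \<rho> \<nu> \<pi> R \<theta> \<alpha> \<beta> = (\<integral>\<^sup>+z. ennreal ((norm (score \<pi> \<theta> z))\<^sup>2 * (?A z)\<^sup>2) \<partial>P)"
    by (simp add: bnpo_variance_def vec_variance_def mean) (simp add: bnpo_gradient_def power_mult_distrib mult.commute)
  also have "\<dots> = (\<integral>\<^sup>+z. ennreal ((norm (score \<pi> \<theta> z))\<^sup>2) \<partial>P) * (\<integral>\<^sup>+z. ennreal ((?A z)\<^sup>2) \<partial>P)"
    using uncorr by (simp add: bnpo_uncorrelated_def square_uncorrelated_def)
  finally show ?thesis
    by (simp add: nn_integral_advantage_square[OF dist])
qed

theorem theorem1:
  fixes \<rho> :: "'q measure" and \<nu> :: "'y measure"
    and \<pi> :: "'p::euclidean_space \<Rightarrow> 'q \<Rightarrow> 'y \<Rightarrow> real"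
    and R :: "'q \<Rightarrow> 'y \<Rightarrow> real"
    and \<theta> :: 'p and a b :: real
  assumes "prob_space \<rho>" and "policy_model \<rho> \<nu> \<pi>"
    and "(\<lambda>(q, y). R q y) \<in> borel_measurable (\<rho> \<Otimes>\<^sub>M \<nu>)"
    and "\<And>q y. q \<in> space \<rho> \<Longrightarrow> y \<in> space \<nu> \<Longrightarrow> R q y \<in> {0, 1}"
    and "AE (q, y) in joint_law \<rho> \<nu> \<pi> \<theta>. (\<lambda>t. ln (\<pi> t q y)) differentiable (at \<theta>)"
    and "score \<pi> \<theta> \<in> borel_measurable (\<rho> \<Otimes>\<^sub>M \<nu>)"
    and "0 < a" and "0 < b"
    and "distributed \<rho> lborel (success_prob \<nu> \<pi> R \<theta>) (\<lambda>x. ennreal (beta_density a b x))"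
    and "0 < (\<integral>\<^sup>+z. ennreal ((norm (score \<pi> \<theta> z))\<^sup>2) \<partial>joint_law \<rho> \<nu> \<pi> \<theta>)"
    and "(\<integral>\<^sup>+z. ennreal ((norm (score \<pi> \<theta> z))\<^sup>2) \<partial>joint_law \<rho> \<nu> \<pi> \<theta>) < \<infinity>"
  shows "(\<forall>\<alpha>>0. \<forall>\<beta>>0. bnpo_uncorrelated \<rho> \<nu> \<pi> R \<theta> \<alpha> \<beta> \<longrightarrow>
            (bnpo_variance \<rho> \<nu> \<pi> R \<theta> \<alpha> \<beta> < \<infinity> \<longleftrightarrow> \<alpha> < (a + 3) / 2 \<and> \<beta> < (b + 3) / 2))
       \<and> ((\<forall>(\<alpha>, \<beta>)\<in>parameter_domain a b. bnpo_uncorrelated \<rho> \<nu> \<pi> R \<theta> \<alpha> \<beta>) \<longrightarrow>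
            (1 + a / 3, 1 + b / 3) \<in> parameter_domain a b \<and>
            (\<forall>(\<alpha>, \<beta>)\<in>parameter_domain a b. (\<alpha>, \<beta>) \<noteq> (1 + a / 3, 1 + b / 3) \<longrightarrow>
               bnpo_variance \<rho> \<nu> \<pi> R \<theta> (1 + a / 3) (1 + b / 3) < bnpo_variance \<rho> \<nu> \<pi> R \<theta> \<alpha> \<beta>))"
proof -
  let ?c = "\<integral>\<^sup>+z. ennreal ((norm (score \<pi> \<theta> z))\<^sup>2) \<partial>joint_law \<rho> \<nu> \<pi> \<theta>"
  have "success_prob \<nu> \<pi> R \<theta> \<in> borel_measurable \<rho>"
    using distributed_measurable[OF assms(9)] by simp
  then have brp: "binary_reward_policy \<rho> \<nu> \<pi> R \<theta>"
    using assms(1-4) by (intro binary_reward_policy.intro) auto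
  note variance = bnpo_variance_eq[OF brp assms(9)]
  have "bnpo_variance \<rho> \<nu> \<pi> R \<theta> \<alpha> \<beta> < \<infinity> \<longleftrightarrow> \<alpha> < (a + 3) / 2 \<and> \<beta> < (b + 3) / 2"
    if "0 < \<alpha>" "0 < \<beta>" "bnpo_uncorrelated \<rho> \<nu> \<pi> R \<theta> \<alpha> \<beta>" for \<alpha> \<beta>
  proof -
    \<comment> \<open>The second moment of the score is positive and finite, so multiplying by it
      preserves both finiteness and infinity.\<close>
    have "bnpo_variance \<rho> \<nu> \<pi> R \<theta> \<alpha> \<beta> < \<infinity> \<longleftrightarrow> beta_second_moment a b \<alpha> \<beta> < \<infinity>"
      using assms(10,11) variance[OF that(3)] by (auto simp: ennreal_mult_less_top)
    then show ?thesis
      using beta_second_moment_finite_iff[of a b \<alpha> \<beta>] assms(7,8) that by simp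
  qed
  \<comment> \<open>The distances to the upper bounds are (a + 3) / 6 and (b + 3) / 6.\<close>
  moreover have dom: "(1 + a / 3, 1 + b / 3) \<in> parameter_domain a b"
    using assms(7,8) by (simp add: parameter_domain_def)
  moreover have "bnpo_variance \<rho> \<nu> \<pi> R \<theta> (1 + a / 3) (1 + b / 3) < bnpo_variance \<rho> \<nu> \<pi> R \<theta> \<alpha> \<beta>"
    if uncorr: "\<forall>(\<alpha>, \<beta>)\<in>parameter_domain a b. bnpo_uncorrelated \<rho> \<nu> \<pi> R \<theta> \<alpha> \<beta>"
      and \<alpha>\<beta>: "(\<alpha>, \<beta>) \<in> parameter_domain a b" "(\<alpha>, \<beta>) \<noteq> (1 + a / 3, 1 + b / 3)" for \<alpha> \<beta>
  proof -
    have "bnpo_uncorrelated \<rho> \<nu> \<pi> R \<theta> (1 + a / 3) (1 + b / 3)" "bnpo_uncorrelated \<rho> \<nu> \<pi> R \<theta> \<alpha> \<beta>"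
      using uncorr dom \<alpha>\<beta>(1) by auto
    \<comment> \<open>The factor \<open>?c\<close> is positive and finite, so the strict inequality
      survives multiplication in \<open>ennreal\<close>.\<close>
    moreover have "?c * beta_second_moment a b (1 + a / 3) (1 + b / 3) < ?c * beta_second_moment a b \<alpha> \<beta>"
      using assms(7,8,10,11) \<alpha>\<beta>
      by (intro ennreal_mult_strict_left_mono beta_second_moment_minimum) (auto simp: parameter_domain_def)
    ultimately show ?thesis by (simp add: variance)
  qed
  ultimately show ?thesis by blast
qed

end
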